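(* Let $\mathcal{H}$ be a complex Hilbert space and let $A\in\mathbb{B}(\mathcal{H})$. Then $$\omega^2(A)\le \frac{1}{2}\,\omega^2\big(|A|+i|A^*|\big)\le \frac{1}{2}\big\|\,|A|^2+|A^*|^2\,\big\|.$$
   Context: $\mathbb{B}(\mathcal{H})$ is the $C^*$-algebra of bounded linear operators on $\mathcal{H}$, with the usual operator norm $\|\cdot\|$; $A^*$ is the adjoint of $A$ and $|A|=(A^*A)^{1/2}$. The numerical radius is $\omega(A)=\sup_{\|x\|=1}|\langle Ax,x\rangle|$, and $\omega^2(A)$ means $(\omega(A))^2$. *)

theory Defs
  imports "HOL-Analysis.Analysis"
begin

class complex_vector = real_vector +
  fixes scaleC :: "complex \<Rightarrow> 'a \<Rightarrow> 'a"  (infixr "*\<^sub>C" 75)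
  assumes scaleC_add_right: "c *\<^sub>C (x + y) = c *\<^sub>C x + c *\<^sub>C y"
    and scaleC_add_left: "(c + d) *\<^sub>C x = c *\<^sub>C x + d *\<^sub>C x"
    and scaleC_scaleC: "c *\<^sub>C (d *\<^sub>C x) = (c * d) *\<^sub>C x"
    and scaleC_one: "1 *\<^sub>C x = x"
    and scaleR_scaleC: "r *\<^sub>R x = complex_of_real r *\<^sub>C x"

text \<open>The inner product is linear in the first argument. The norm axioms and completeness
  come from the library class \<^class>\<open>banach\<close>; the zero space is included.\<close>

class chilbert_space = banach + complex_vector +
  fixes cinner :: "'a \<Rightarrow> 'a \<Rightarrow> complex"
  assumes cinner_add_left: "cinner (x + y) z = cinner x z + cinner y z"
    and cinner_scaleC_left: "cinner (c *\<^sub>C x) y = c * cinner x y"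
    and cinner_commute: "cinner x y = cnj (cinner y x)"
    and cinner_self: "cinner x x = complex_of_real ((norm x)\<^sup>2)"

text \<open>Operators are functions satisfying the predicate below; their operator norm is the library's
  \<^const>\<open>onorm\<close>.\<close>

definition bounded_clinear :: "('a::chilbert_space \<Rightarrow> 'a) \<Rightarrow> bool" where
  "bounded_clinear A \<longleftrightarrow> bounded_linear A \<and> (\<forall>c x. A (c *\<^sub>C x) = c *\<^sub>C A x)"

definition adjoint_op :: "('a::chilbert_space \<Rightarrow> 'a) \<Rightarrow> 'a \<Rightarrow> 'a" where
  "adjoint_op A = (THE B. bounded_clinear B \<and> (\<forall>x y. cinner (A x) y = cinner x (B y)))"

definition positive_op :: "('a::chilbert_space \<Rightarrow> 'a) \<Rightarrow> bool" where
  "positive_op T \<longleftrightarrow> bounded_clinear T \<and> (\<forall>x. cinner (T x) x \<in> \<real>\<^sub>\<ge>\<^sub>0)"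

definition sqrt_op :: "('a::chilbert_space \<Rightarrow> 'a) \<Rightarrow> 'a \<Rightarrow> 'a" where
  "sqrt_op T = (THE S. positive_op S \<and> S \<circ> S = T)"

definition abs_op :: "('a::chilbert_space \<Rightarrow> 'a) \<Rightarrow> 'a \<Rightarrow> 'a" where
  "abs_op A = sqrt_op (adjoint_op A \<circ> A)"

text \<open>The supremum is taken in \<open>[0, \<infinity>)\<close>: inserting \<open>0\<close> only matters on the zero space, which has
  no unit vectors and where the real supremum of the empty set would be unspecified.\<close>

definition numerical_radius :: "('a::chilbert_space \<Rightarrow> 'a) \<Rightarrow> real" where
  "numerical_radius A = Sup (insert 0 {cmod (cinner (A x) x) | x. norm x = 1})"

end

theory Submission
  imports Defs
begin

text \<open>For a unit vector \<open>x\<close> put \<open>a = \<langle>|A|x, x\<rangle>\<close> and \<open>b = \<langle>|A\<^sup>*|x, x\<rangle>\<close>. The mixed Schwarz inequality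
  gives \<open>|\<langle>Ax, x\<rangle>|\<^sup>2 \<le> a b \<le> (a\<^sup>2 + b\<^sup>2)/2\<close>, and \<open>a\<^sup>2 + b\<^sup>2\<close> is both
  \<open>|\<langle>(|A| + i|A\<^sup>*|)x, x\<rangle>|\<^sup>2\<close> and at most
  \<open>\<parallel>|A|x\<parallel>\<^sup>2 + \<parallel>|A\<^sup>*|x\<parallel>\<^sup>2 = \<langle>(|A|\<^sup>2 + |A\<^sup>*|\<^sup>2)x, x\<rangle>\<close>. Instead of the polar decomposition, the
  mixed Schwarz inequality rests on the intertwining relation \<open>A|A| = |A\<^sup>*|A\<close>, which holds
  because the square root is a norm limit of polynomials.\<close>

section \<open>The inner product\<close>

lemma cinner_add_right: "cinner x (y + z) = cinner x y + cinner x (z::'a::chilbert_space)"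
  by (metis cinner_add_left cinner_commute complex_cnj_add)

lemma cinner_scaleC_right: "cinner x (c *\<^sub>C y) = cnj c * cinner x (y::'a::chilbert_space)"
  by (metis cinner_commute cinner_scaleC_left complex_cnj_mult)

lemma cinner_scaleR_left: "cinner (r *\<^sub>R x) y = of_real r * cinner x (y::'a::chilbert_space)"
  by (simp add: scaleR_scaleC cinner_scaleC_left)

lemma cinner_scaleR_right: "cinner x (r *\<^sub>R y) = of_real r * cinner x (y::'a::chilbert_space)"
  by (simp add: scaleR_scaleC cinner_scaleC_right)

lemma cinner_zero_left [simp]: "cinner 0 (y::'a::chilbert_space) = 0"
  using cinner_scaleR_left[of 0 0 y] by simp

lemma cinner_zero_right [simp]: "cinner (y::'a::chilbert_space) 0 = 0"
  using cinner_scaleR_right[of y 0 0] by simp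

lemma cinner_minus_left: "cinner (- x) y = - cinner x (y::'a::chilbert_space)"
  using cinner_scaleR_left[of "-1" x y] by simp

lemma cinner_minus_right: "cinner x (- y) = - cinner x (y::'a::chilbert_space)"
  using cinner_scaleR_right[of x "-1" y] by simp

lemma cinner_diff_left: "cinner (x - y) z = cinner x z - cinner y (z::'a::chilbert_space)"
  using cinner_add_left[of x "- y" z] by (simp add: cinner_minus_left)

lemma cinner_diff_right: "cinner z (x - y) = cinner z x - cinner z (y::'a::chilbert_space)"
  using cinner_add_right[of z x "- y"] by (simp add: cinner_minus_right)

lemmas cinner_simps = cinner_add_left cinner_add_right cinner_diff_left cinner_diff_right
  cinner_scaleR_left cinner_scaleR_right cinner_scaleC_left cinner_scaleC_right

lemma Re_cinner_self: "Re (cinner x x) = (norm (x::'a::chilbert_space))\<^sup>2"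
  by (simp add: cinner_self)

lemma Re_cinner_commute: "Re (cinner x y) = Re (cinner y (x::'a::chilbert_space))"
  using cinner_commute[of x y] by simp

lemma cinner_eqI:
  fixes x y :: "'a::chilbert_space"
  assumes "\<And>z. cinner z x = cinner z y"
  shows "x = y"
proof -
  have "cinner (x - y) (x - y) = 0"
    using assms[of "x - y"] by (simp add: cinner_diff_right)
  then show ?thesis by (simp add: cinner_self)
qed

lemma parallelogram:
  fixes x y :: "'a::chilbert_space"
  shows "(norm (x + y))\<^sup>2 + (norm (x - y))\<^sup>2 = 2 * (norm x)\<^sup>2 + 2 * (norm y)\<^sup>2"
  unfolding Re_cinner_self[symmetric] by (simp add: cinner_simps)

section \<open>Positive operators\<close>

lemma bounded_clinear_imp_bounded_linear: "bounded_clinear A \<Longrightarrow> bounded_linear A"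
  by (simp add: bounded_clinear_def)

lemma bounded_clinear_scaleC: "bounded_clinear A \<Longrightarrow> A (c *\<^sub>C x) = c *\<^sub>C A x"
  by (simp add: bounded_clinear_def)

lemma bounded_clinear_compose:
  "bounded_clinear A \<Longrightarrow> bounded_clinear B \<Longrightarrow> bounded_clinear (A \<circ> B)"
  unfolding bounded_clinear_def o_def by (auto intro: bounded_linear_compose)

lemma positive_op_imp_bounded_linear: "positive_op T \<Longrightarrow> bounded_linear T"
  by (simp add: positive_op_def bounded_clinear_def)

lemma positive_op_cinner_self:
  assumes "positive_op T"
  shows "cinner (T x) x = of_real (Re (cinner (T x) x))" "0 \<le> Re (cinner (T x) x)"
  using assms by (auto simp: positive_op_def complex_nonneg_Reals_iff complex_eq_iff)

text \<open>Polarisation: the form is real on the diagonal, and its vanishing imaginary parts at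
  \<open>x + y\<close> and \<open>x + i y\<close> show that \<open>cinner (T y) x\<close> is the
  conjugate of \<open>cinner (T x) y\<close>.\<close>

lemma positive_op_symmetric:
  assumes "positive_op T"
  shows "cinner (T x) y = cinner x (T y)"
proof -
  interpret T: bounded_linear T using assms by (rule positive_op_imp_bounded_linear)
  have im: "Im (cinner (T z) z) = 0" for z
    using positive_op_cinner_self(1)[OF assms, of z] by (metis Im_complex_of_real)
  have sc: "T (\<i> *\<^sub>C y) = \<i> *\<^sub>C T y"
    using assms by (simp add: positive_op_def bounded_clinear_def)
  have "Im (cinner (T x) y) + Im (cinner (T y) x) = 0"
    using im[of "x + y"] im[of x] im[of y] by (simp add: T.add cinner_simps)
  moreover have "Re (cinner (T y) x) - Re (cinner (T x) y) = 0"
    using im[of "x + \<i> *\<^sub>C y"] im[of x] im[of y] by (simp add: T.add sc cinner_simps)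
  ultimately show ?thesis
    using cinner_commute[of x "T y"] by (simp add: complex_eq_iff)
qed

text \<open>The form is nonnegative at \<open>x - t w y\<close> with
  \<open>w = cinner (T x) y\<close>. The factor \<open>w\<close> absorbs the phase, which leaves a
  quadratic in the real variable \<open>t\<close>.\<close>

lemma positive_op_Cauchy_Schwarz:
  assumes "positive_op T"
  shows "(cmod (cinner (T x) y))\<^sup>2 \<le> Re (cinner (T x) x) * Re (cinner (T y) y)"
proof -
  interpret T: bounded_linear T using assms by (rule positive_op_imp_bounded_linear)
  define a where "a = Re (cinner (T x) x)"
  define b where "b = Re (cinner (T y) y)"
  define w where "w = cinner (T x) y"
  have T_scaleC: "T (c *\<^sub>C z) = c *\<^sub>C T z" for c z
    using assms by (simp add: positive_op_def bounded_clinear_def)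
  have w': "cinner (T y) x = cnj w"
    using positive_op_symmetric[OF assms, of y x] cinner_commute[of y "T x"]
    by (simp add: w_def)
  have quad: "0 \<le> a - 2 * t * (cmod w)\<^sup>2 + t\<^sup>2 * (cmod w)\<^sup>2 * b" for t
  proof -
    define l where "l = - (of_real t * w)"
    have "0 \<le> Re (cinner (T (x + l *\<^sub>C y)) (x + l *\<^sub>C y))"
      using assms by (rule positive_op_cinner_self)
    also have "cinner (T (x + l *\<^sub>C y)) (x + l *\<^sub>C y) =
        cinner (T x) x + cnj l * w + l * cnj w + l * cnj l * cinner (T y) y"
      by (simp add: T.add T_scaleC cinner_simps w' w_def[symmetric] algebra_simps)
    also have "\<dots> = of_real a - of_real (2 * t * (cmod w)\<^sup>2) + of_real (t\<^sup>2 * (cmod w)\<^sup>2 * b)"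
      using positive_op_cinner_self(1)[OF assms, of x] positive_op_cinner_self(1)[OF assms, of y]
        complex_norm_square[of w]
      by (simp add: a_def b_def l_def algebra_simps power2_eq_square)
    finally show ?thesis by simp
  qed
  have ab: "0 \<le> a" "0 \<le> b"
    using positive_op_cinner_self(2)[OF assms] by (auto simp: a_def b_def)
  \<comment> \<open>The form may be degenerate. For \<open>b = 0\<close> the bound is affine in
    \<open>t\<close>, and a large \<open>t\<close> refutes a nonzero \<open>w\<close>; otherwise the
    minimiser \<open>t = 1 / b\<close> gives the claim.\<close>
  have "(cmod w)\<^sup>2 \<le> a * b"
  proof (cases "b = 0")
    case True
    have "w = 0"
    proof (rule ccontr)
      assume "w \<noteq> 0"
      then have pos: "0 < (cmod w)\<^sup>2" by simp
      have "0 \<le> a - 2 * ((a + 1) / (cmod w)\<^sup>2) * (cmod w)\<^sup>2"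
        using quad[of "(a + 1) / (cmod w)\<^sup>2"] True by simp
      also have "\<dots> = a - 2 * (a + 1)" using pos by simp
      finally show False using ab by simp
    qed
    then show ?thesis using True by simp
  next
    case False
    then have "0 < b" using ab by simp
    have "0 \<le> a - (cmod w)\<^sup>2 / b"
      using quad[of "1 / b"] \<open>0 < b\<close> by (simp add: power2_eq_square field_simps)
    then show ?thesis using \<open>0 < b\<close> by (simp add: field_simps)
  qed
  then show ?thesis by (simp add: a_def b_def w_def)
qed

text \<open>Makes the ordinary Cauchy-Schwarz inequality an instance of the one for positive
  forms.\<close>

lemma positive_op_id: "positive_op (\<lambda>x. x)"
  by (simp add: positive_op_def bounded_clinear_def bounded_linear_ident cinner_self
      complex_nonneg_Reals_iff)

lemma Cauchy_Schwarz_cinner: "cmod (cinner x y) \<le> norm x * norm (y::'a::chilbert_space)"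
proof (rule power2_le_imp_le)
  show "(cmod (cinner x y))\<^sup>2 \<le> (norm x * norm y)\<^sup>2"
    using positive_op_Cauchy_Schwarz[OF positive_op_id, of x y]
    by (simp add: Re_cinner_self power_mult_distrib)
qed simp

lemma bounded_bilinear_cinner: "bounded_bilinear (cinner :: 'a::chilbert_space \<Rightarrow> 'a \<Rightarrow> complex)"
proof
  show "\<exists>K. \<forall>x y::'a. norm (cinner x y) \<le> norm x * norm y * K"
    by (intro exI[of _ 1]) (simp add: Cauchy_Schwarz_cinner)
qed (simp_all add: cinner_simps scaleR_conv_of_real)

lemmas tendsto_cinner [tendsto_intros] = bounded_bilinear.tendsto[OF bounded_bilinear_cinner]
lemmas continuous_on_cinner [continuous_intros] =
  bounded_bilinear.continuous_on[OF bounded_bilinear_cinner]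

text \<open>Cauchy-Schwarz for the form, tested against \<open>y = T x\<close>. This drives the
  uniqueness of square roots.\<close>

lemma positive_op_eq_0:
  assumes "positive_op T" and "Re (cinner (T x) x) = 0"
  shows "T x = 0"
  using positive_op_Cauchy_Schwarz[OF assms(1), of x "T x"] assms(2) by (simp add: cinner_self)

section \<open>The Riesz representation and adjoints\<close>

text \<open>The representing vector minimises \<open>\<parallel>x\<parallel>\<^sup>2 - 2 f x\<close> over \<open>V\<close>; minimising sequences are
  Cauchy by the parallelogram law. For \<open>f = Re \<langle>\<cdot>, x\<rangle>\<close> this is the orthogonal projection of \<open>x\<close>
  to \<open>V\<close>.\<close>

lemma Riesz_subspace:
  fixes f :: "'a::chilbert_space \<Rightarrow> real"
  assumes f: "bounded_linear f" and V: "subspace V" "closed V"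
  obtains z where "z \<in> V" "\<And>h. h \<in> V \<Longrightarrow> Re (cinner h z) = f h"
proof -
  interpret f: bounded_linear f by fact
  define J where "J x = (norm x)\<^sup>2 - 2 * f x" for x
  define m where "m = Inf (J ` V)"
  obtain K where K: "\<And>x. norm (f x) \<le> norm x * K" using f.bounded by blast
  have low: "- K\<^sup>2 \<le> J x" for x
  proof -
    have "f x \<le> norm x * K" using K[of x] by simp
    moreover have "0 \<le> (norm x - K)\<^sup>2" by simp
    ultimately show ?thesis unfolding J_def by (simp add: power2_diff)
  qed
  then have bdd: "bdd_below (J ` V)" by (auto intro!: bdd_belowI)
  have ne: "J ` V \<noteq> {}" using subspace_0[OF V(1)] by auto
  have m_le: "m \<le> J x" if "x \<in> V" for x
    unfolding m_def using that bdd by (auto intro: cInf_lower)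
  have "\<exists>x\<in>V. J x < m + 1 / Suc n" for n
  proof -
    have "m < m + 1 / Suc n" by simp
    then show ?thesis unfolding m_def using cInf_lessD[OF ne] by blast
  qed
  then obtain X where X: "\<And>n. X n \<in> V" "\<And>n. J (X n) < m + 1 / Suc n" by metis
  \<comment> \<open>The midpoint lies in \<open>V\<close>, so \<open>m\<close> bounds
    \<open>J\<close> there; the parallelogram law turns this into a distance estimate.\<close>
  have dist: "(norm (x - y))\<^sup>2 \<le> 2 * (J x - m) + 2 * (J y - m)" if "x \<in> V" "y \<in> V" for x y
  proof -
    have "m \<le> J ((1/2) *\<^sub>R (x + y))"
      using that V(1) by (intro m_le) (simp add: subspace_add subspace_scale)
    also have "\<dots> = (norm (x + y))\<^sup>2 / 4 - f x - f y"
      unfolding J_def f.scaleR f.add norm_scaleR by (simp add: power_divide field_simps)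
    finally show ?thesis using parallelogram[of x y] by (simp add: J_def)
  qed
  have "Cauchy X"
  proof (rule metric_CauchyI)
    fix e :: real assume "0 < e"
    \<comment> \<open>This puts \<open>1 / Suc M\<close> below a quarter of the square of
      \<open>e\<close>; \<open>dist\<close> adds up four such terms.\<close>
    then obtain M where M: "4 / e\<^sup>2 < real (Suc M)"
      by (meson reals_Archimedean2 less_trans lessI of_nat_less_iff)
    have small: "J (X n) - m < e\<^sup>2 / 4" if "n \<ge> M" for n
    proof -
      have "J (X n) - m < 1 / Suc n" using X(2)[of n] by simp
      also have "\<dots> \<le> 1 / Suc M" using that by (simp add: frac_le)
      also have "\<dots> < e\<^sup>2 / 4" using M \<open>0 < e\<close> by (simp add: field_simps)
      finally show ?thesis .
    qed
    show "\<exists>M. \<forall>i\<ge>M. \<forall>n\<ge>M. dist (X i) (X n) < e"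
    proof (intro exI[of _ M] allI impI)
      fix i n assume "M \<le> i" "M \<le> n"
      have "(norm (X i - X n))\<^sup>2 < e\<^sup>2"
        using dist[OF X(1)[of i] X(1)[of n]] small[OF \<open>M \<le> i\<close>] small[OF \<open>M \<le> n\<close>] by simp
      then show "dist (X i) (X n) < e"
        using \<open>0 < e\<close> by (simp add: dist_norm power_less_imp_less_base)
    qed
  qed
  then obtain z where z: "X \<longlonglongrightarrow> z" by (auto simp: Cauchy_convergent_iff convergent_def)
  have zV: "z \<in> V" using closed_sequentially[OF V(2)] X(1) z by blast
  have "J z \<le> m"
  proof (rule LIMSEQ_le)
    show "(\<lambda>n. J (X n)) \<longlonglongrightarrow> J z"
      unfolding J_def by (intro tendsto_intros z f.tendsto)
    show "(\<lambda>n. m + 1 / Suc n) \<longlonglongrightarrow> m"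
      using tendsto_add[OF tendsto_const LIMSEQ_Suc[OF lim_1_over_n], of m] by simp
    show "\<exists>N. \<forall>n\<ge>N. J (X n) \<le> m + 1 / Suc n" using X(2) less_imp_le by blast
  qed
  have "Re (cinner h z) = f h" if h: "h \<in> V" for h
  proof -
    \<comment> \<open>\<open>2 * d\<close> is the derivative of \<open>J\<close> at the minimiser
      \<open>z\<close> in direction \<open>h\<close>.\<close>
    define d where "d = Re (cinner h z) - f h"
    have quad: "0 \<le> t\<^sup>2 * (norm h)\<^sup>2 + 2 * t * d" for t
    proof -
      have "J z \<le> J (z + t *\<^sub>R h)"
        using \<open>J z \<le> m\<close> m_le[of "z + t *\<^sub>R h"] zV h V(1)
        by (simp add: subspace_add subspace_scale)
      also have "\<dots> = J z + t\<^sup>2 * (norm h)\<^sup>2 + 2 * t * d"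
        unfolding J_def d_def Re_cinner_self[symmetric]
        using Re_cinner_commute[of h z]
        by (simp add: cinner_simps f.add f.scaleR algebra_simps power2_eq_square)
      finally show ?thesis by simp
    qed
    \<comment> \<open>The step \<open>t = - (s * d)\<close> is short enough for the linear term to
      dominate; the \<open>+ 1\<close> covers \<open>h = 0\<close>.\<close>
    define s where "s = 1 / ((norm h)\<^sup>2 + 1)"
    have "0 < (norm h)\<^sup>2 + 1" by (simp add: add_nonneg_pos)
    then have "0 < s" "s * (norm h)\<^sup>2 < 1"
      by (auto simp: s_def divide_less_eq)
    have "0 \<le> d\<^sup>2 * s * (s * (norm h)\<^sup>2 - 2)"
      using quad[of "- (s * d)"] by (simp add: algebra_simps power2_eq_square)
    moreover have "d\<^sup>2 * s * (s * (norm h)\<^sup>2 - 2) \<le> d\<^sup>2 * s * (- 1)"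
      using \<open>0 < s\<close> \<open>s * (norm h)\<^sup>2 < 1\<close> by (intro mult_left_mono) auto
    ultimately have "d\<^sup>2 * s \<le> 0" by simp
    then have "d = 0" using \<open>0 < s\<close> by (simp add: mult_le_0_iff)
    then show ?thesis by (simp add: d_def)
  qed
  with zV that show ?thesis by blast
qed

text \<open>Riesz on the whole space represents the real part of \<open>cinner (A x) y\<close> for
  fixed \<open>y\<close>. Complex homogeneity of \<open>A\<close> recovers the imaginary part on
  replacing \<open>h\<close> by \<open>i h\<close>.\<close>

lemma adjoint_exists:
  assumes A: "bounded_clinear A"
  obtains B where "bounded_clinear B" "\<And>x y. cinner (A x) y = cinner x (B y)"
proof -
  interpret A: bounded_linear A using A by (rule bounded_clinear_imp_bounded_linear)
  have "\<exists>z. \<forall>x. cinner (A x) y = cinner x z" for y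
  proof -
    have "bounded_linear (\<lambda>x. Re (cinner (A x) y))"
      by (intro bounded_linear_compose[OF bounded_linear_Re]
          bounded_linear_compose[OF bounded_bilinear.bounded_linear_left[OF bounded_bilinear_cinner]]
          A.bounded_linear_axioms)
    from Riesz_subspace[OF this subspace_UNIV closed_UNIV]
    obtain z where z: "\<And>h. Re (cinner h z) = Re (cinner (A h) y)" by auto
    have "Im (cinner h z) = Im (cinner (A h) y)" for h
      using z[of "\<i> *\<^sub>C h"] by (simp add: bounded_clinear_scaleC[OF A] cinner_simps)
    with z show ?thesis by (metis complex_eqI)
  qed
  then obtain B where B: "\<And>x y. cinner (A x) y = cinner x (B y)" by metis
  obtain K where K: "\<And>x. norm (A x) \<le> norm x * K" using A.bounded by blast
  have "bounded_linear B"
  proof (rule bounded_linear_intro)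
    show "B (x + y) = B x + B y" for x y
      by (rule cinner_eqI) (simp add: B[symmetric] cinner_simps)
    show "B (r *\<^sub>R x) = r *\<^sub>R B x" for r x
      by (rule cinner_eqI) (simp add: B[symmetric] cinner_simps)
    show "norm (B y) \<le> norm y * K" for y
    proof (cases "B y = 0")
      case True
      have "0 \<le> norm y * K"
        using K[of y] norm_ge_zero[of "A y"] by linarith
      then show ?thesis using True by simp
    next
      case False
      have "(norm (B y))\<^sup>2 = cmod (cinner (A (B y)) y)" by (simp add: B cinner_self norm_power)
      also have "\<dots> \<le> norm (B y) * K * norm y"
        using Cauchy_Schwarz_cinner[of "A (B y)" y] K[of "B y"]
        by (meson mult_right_mono norm_ge_zero order_trans)
      finally show ?thesis using False by (simp add: power2_eq_square mult_ac)
    qed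
  qed
  moreover have "B (c *\<^sub>C x) = c *\<^sub>C B x" for c x
    by (rule cinner_eqI) (simp add: B[symmetric] cinner_simps)
  ultimately have "bounded_clinear B" by (simp add: bounded_clinear_def)
  with B that show ?thesis by blast
qed

text \<open>Inner products separate points, so the description in \<open>adjoint_op\<close> has only
  one candidate.\<close>

lemma adjoint_op_eqI:
  assumes "bounded_clinear B" "\<And>x y. cinner (A x) y = cinner x (B y)"
  shows "adjoint_op A = B"
  unfolding adjoint_op_def
proof (rule the_equality)
  show "bounded_clinear B \<and> (\<forall>x y. cinner (A x) y = cinner x (B y))" using assms by blast
  show "C = B" if "bounded_clinear C \<and> (\<forall>x y. cinner (A x) y = cinner x (C y))" for C
    using that assms(2) by (intro ext cinner_eqI) metis
qed

lemma
  assumes "bounded_clinear A"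
  shows bounded_clinear_adjoint_op: "bounded_clinear (adjoint_op A)"
    and cinner_adjoint_op: "cinner (A x) y = cinner x (adjoint_op A y)"
proof -
  obtain B where B: "bounded_clinear B" "\<And>x y. cinner (A x) y = cinner x (B y)"
    using adjoint_exists[OF assms] by blast
  have "adjoint_op A = B" using B by (rule adjoint_op_eqI)
  with B show "bounded_clinear (adjoint_op A)" "cinner (A x) y = cinner x (adjoint_op A y)"
    by simp_all
qed

lemma cinner_adjoint_op_left:
  "bounded_clinear A \<Longrightarrow> cinner (adjoint_op A x) y = cinner x (A y)"
  by (metis cinner_adjoint_op cinner_commute)

lemma adjoint_op_adjoint_op: "bounded_clinear A \<Longrightarrow> adjoint_op (adjoint_op A) = A"
  by (rule adjoint_op_eqI) (auto simp: cinner_adjoint_op_left)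

lemma positive_op_adjoint_compose:
  assumes "bounded_clinear A"
  shows "positive_op (adjoint_op A \<circ> A)"
  using assms by (simp add: positive_op_def bounded_clinear_compose bounded_clinear_adjoint_op
      cinner_adjoint_op_left cinner_self complex_nonneg_Reals_iff)


section \<open>Square roots of positive operators\<close>

text \<open>A fixed point \<open>Y\<close> of the map \<open>Y \<mapsto> (B + Y\<^sup>2)/2\<close> satisfies \<open>(1 - Y)\<^sup>2 = 1 - B\<close>. The
  increments of the iteration are dominated in norm by those of the scalar iteration for \<open>B = 1\<close>,
  so it converges in norm as soon as \<open>\<parallel>B\<parallel> \<le> 1\<close>.\<close>

primrec sqrt_iter :: "('a::real_normed_vector \<Rightarrow>\<^sub>L 'a) \<Rightarrow> nat \<Rightarrow> 'a \<Rightarrow>\<^sub>L 'a" where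
  "sqrt_iter B 0 = 0"
| "sqrt_iter B (Suc n) = (1/2) *\<^sub>R (B + (sqrt_iter B n o\<^sub>L sqrt_iter B n))"

primrec sqrt_majorant :: "nat \<Rightarrow> real" where
  "sqrt_majorant 0 = 0"
| "sqrt_majorant (Suc n) = (1 + (sqrt_majorant n)\<^sup>2) / 2"

definition sqrt_lim :: "('a::real_normed_vector \<Rightarrow>\<^sub>L 'a) \<Rightarrow> 'a \<Rightarrow>\<^sub>L 'a" where
  "sqrt_lim B = lim (sqrt_iter B)"

lemma sqrt_majorant_bounds: "0 \<le> sqrt_majorant n \<and> sqrt_majorant n \<le> 1"
proof (induction n)
  case (Suc n)
  then have "(sqrt_majorant n)\<^sup>2 \<le> 1" by (simp add: power_le_one)
  then show ?case by simp
qed simp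

text \<open>If \<open>q\<close> is the current value, the increment is half the square of
  \<open>q - 1\<close>.\<close>

lemma incseq_sqrt_majorant: "incseq sqrt_majorant"
proof (rule incseq_SucI)
  show "sqrt_majorant n \<le> sqrt_majorant (Suc n)" for n
    using sum_power2_ge_zero[of "sqrt_majorant n - 1" 0] by (simp add: power2_diff)
qed

lemma norm_sqrt_iter:
  assumes "norm B \<le> 1"
  shows "norm (sqrt_iter B n) \<le> sqrt_majorant n"
proof (induction n)
  case (Suc n)
  let ?Y = "sqrt_iter B n"
  have "norm (?Y o\<^sub>L ?Y) \<le> norm ?Y * norm ?Y" by (rule norm_blinfun_compose)
  also have "\<dots> \<le> sqrt_majorant n * sqrt_majorant n"
    using Suc sqrt_majorant_bounds by (intro mult_mono) auto
  finally have "norm (B + (?Y o\<^sub>L ?Y)) \<le> 1 + (sqrt_majorant n)\<^sup>2"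
    using assms norm_triangle_ineq[of B "?Y o\<^sub>L ?Y"] by (simp add: power2_eq_square)
  then show ?case by simp
qed simp

lemma norm_sqrt_iter_diff:
  assumes "norm B \<le> 1"
  shows "norm (sqrt_iter B (Suc n) - sqrt_iter B n) \<le> sqrt_majorant (Suc n) - sqrt_majorant n"
proof (induction n)
  case 0
  then show ?case using assms by simp
next
  case (Suc n)
  define Y where "Y = sqrt_iter B n"
  define Z where "Z = sqrt_iter B (Suc n)"
  define y where "y = sqrt_majorant n"
  define z where "z = sqrt_majorant (Suc n)"
  have Y: "norm Y \<le> y" and Z: "norm Z \<le> z"
    unfolding Y_def Z_def y_def z_def by (rule norm_sqrt_iter[OF assms])+
  have IH: "norm (Z - Y) \<le> z - y"
    using Suc by (simp only: Y_def Z_def y_def z_def)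
  have pos: "0 \<le> y" "0 \<le> z" using sqrt_majorant_bounds by (simp_all only: y_def z_def)
  have "sqrt_iter B (Suc (Suc n)) - Z = (1/2) *\<^sub>R (B + (Z o\<^sub>L Z)) - (1/2) *\<^sub>R (B + (Y o\<^sub>L Y))"
    unfolding sqrt_iter.simps(2)[of B "Suc n"] Z_def[symmetric]
    by (subst (3) Z_def) (simp add: Y_def)
  \<comment> \<open>This splitting of a difference of squares holds without commutativity; the
    majorant obeys the same identity with scalars.\<close>
  also have "\<dots> = (1/2) *\<^sub>R ((Z o\<^sub>L (Z - Y)) + ((Z - Y) o\<^sub>L Y))"
    by (simp add: bounded_bilinear.diff_left[OF bounded_bilinear_blinfun_compose]
        bounded_bilinear.diff_right[OF bounded_bilinear_blinfun_compose] algebra_simps)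
  finally have eq: "norm (sqrt_iter B (Suc (Suc n)) - Z) =
      1/2 * norm ((Z o\<^sub>L (Z - Y)) + ((Z - Y) o\<^sub>L Y))" by simp
  have "norm (Z o\<^sub>L (Z - Y)) \<le> z * (z - y)"
    using norm_blinfun_compose[of Z "Z - Y"] mult_mono[OF Z IH] pos by simp
  moreover have "norm ((Z - Y) o\<^sub>L Y) \<le> (z - y) * y"
    using norm_blinfun_compose[of "Z - Y" Y] mult_mono[OF IH Y] norm_ge_zero[of "Z - Y"] IH
    by (meson norm_ge_zero order_trans)
  ultimately have "norm ((Z o\<^sub>L (Z - Y)) + ((Z - Y) o\<^sub>L Y)) \<le> z\<^sup>2 - y\<^sup>2"
    using norm_triangle_ineq[of "Z o\<^sub>L (Z - Y)" "(Z - Y) o\<^sub>L Y"]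
    by (simp add: power2_eq_square algebra_simps)
  moreover have maj: "sqrt_majorant (Suc (Suc n)) - z = 1/2 * (z\<^sup>2 - y\<^sup>2)"
  proof -
    have "sqrt_majorant (Suc (Suc n)) - z = (1 + z\<^sup>2) / 2 - (1 + y\<^sup>2) / 2"
      by (simp only: sqrt_majorant.simps z_def y_def)
    also have "\<dots> = 1/2 * (z\<^sup>2 - y\<^sup>2)" by (simp add: field_simps)
    finally show ?thesis .
  qed
  ultimately show ?case unfolding Z_def[symmetric] z_def[symmetric] eq maj by simp
qed

text \<open>The increments of the bounded increasing majorant telescope to a convergent series, so
  those of the iteration are absolutely summable.\<close>

lemma sqrt_iter_tendsto:
  fixes B :: "'a::banach \<Rightarrow>\<^sub>L 'a"
  assumes "norm B \<le> 1"
  shows "sqrt_iter B \<longlonglongrightarrow> sqrt_lim B"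
proof -
  obtain l where "sqrt_majorant \<longlonglongrightarrow> l"
    using incseq_convergent[OF incseq_sqrt_majorant] sqrt_majorant_bounds by blast
  then have "summable (\<lambda>n. sqrt_majorant (Suc n) - sqrt_majorant n)"
    by (rule telescope_summable)
  then have "summable (\<lambda>n. sqrt_iter B (Suc n) - sqrt_iter B n)"
    by (rule summable_comparison_test'[where N = 0]) (rule norm_sqrt_iter_diff[OF assms])
  from summable_LIMSEQ[OF this] have "convergent (sqrt_iter B)"
    unfolding sum_lessThan_telescope by (auto simp: convergent_def)
  then show ?thesis unfolding sqrt_lim_def by (rule convergent_LIMSEQ_iff[THEN iffD1])
qed

lemma norm_sqrt_lim:
  fixes B :: "'a::banach \<Rightarrow>\<^sub>L 'a"
  assumes "norm B \<le> 1"
  shows "norm (sqrt_lim B) \<le> 1"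
  using tendsto_norm[OF sqrt_iter_tendsto[OF assms]]
  by (rule LIMSEQ_le_const2) (meson norm_sqrt_iter[OF assms] sqrt_majorant_bounds order_trans)

lemma sqrt_lim_fixpoint:
  fixes B :: "'a::banach \<Rightarrow>\<^sub>L 'a"
  assumes "norm B \<le> 1"
  shows "sqrt_lim B = (1/2) *\<^sub>R (B + (sqrt_lim B o\<^sub>L sqrt_lim B))"
proof (rule LIMSEQ_unique)
  show "(\<lambda>n. sqrt_iter B (Suc n)) \<longlonglongrightarrow> sqrt_lim B"
    using sqrt_iter_tendsto[OF assms] by (rule LIMSEQ_Suc)
  show "(\<lambda>n. sqrt_iter B (Suc n)) \<longlonglongrightarrow> (1/2) *\<^sub>R (B + (sqrt_lim B o\<^sub>L sqrt_lim B))"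
    unfolding sqrt_iter.simps
    by (intro tendsto_intros bounded_bilinear.tendsto[OF bounded_bilinear_blinfun_compose]
        sqrt_iter_tendsto[OF assms])
qed

text \<open>Every iterate is a polynomial in \<open>B\<close>, so the relation survives each step
  and the limit. Taking \<open>B' = B\<close> gives commutation.\<close>

lemma sqrt_lim_intertwines:
  fixes B :: "'a::banach \<Rightarrow>\<^sub>L 'a" and B' :: "'b::banach \<Rightarrow>\<^sub>L 'b"
  assumes "norm B \<le> 1" "norm B' \<le> 1" and "\<And>x. C (B x) = B' (C x)" and C: "bounded_linear C"
  shows "C (sqrt_lim B x) = sqrt_lim B' (C x)"
proof -
  interpret C: bounded_linear C by fact
  have iter: "C (sqrt_iter B n x) = sqrt_iter B' n (C x)" for n x
    by (induction n arbitrary: x) (simp_all add: C.zero C.scaleR C.add assms(3) blinfun.bilinear_simps)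
  show ?thesis
  proof (rule LIMSEQ_unique)
    show "(\<lambda>n. C (sqrt_iter B n x)) \<longlonglongrightarrow> C (sqrt_lim B x)"
      by (intro C.tendsto blinfun.tendsto sqrt_iter_tendsto assms tendsto_const)
    show "(\<lambda>n. C (sqrt_iter B n x)) \<longlonglongrightarrow> sqrt_lim B' (C x)"
      unfolding iter by (intro blinfun.tendsto sqrt_iter_tendsto assms tendsto_const)
  qed
qed

lemma sqrt_lim_symmetric:
  fixes B :: "'a::chilbert_space \<Rightarrow>\<^sub>L 'a"
  assumes "norm B \<le> 1" and sym: "\<And>x y. cinner (B x) y = cinner x (B y)"
  shows "cinner (sqrt_lim B x) y = cinner x (sqrt_lim B y)"
proof -
  have iter: "cinner (sqrt_iter B n x) y = cinner x (sqrt_iter B n y)" for n x y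
    by (induction n arbitrary: x y) (simp_all add: cinner_simps sym blinfun.bilinear_simps)
  show ?thesis
  proof (rule LIMSEQ_unique)
    show "(\<lambda>n. cinner (sqrt_iter B n x) y) \<longlonglongrightarrow> cinner (sqrt_lim B x) y"
      by (intro tendsto_cinner blinfun.tendsto sqrt_iter_tendsto assms tendsto_const)
    show "(\<lambda>n. cinner (sqrt_iter B n x) y) \<longlonglongrightarrow> cinner x (sqrt_lim B y)"
      unfolding iter by (intro tendsto_cinner blinfun.tendsto sqrt_iter_tendsto assms tendsto_const)
  qed
qed

text \<open>Lets multiplication by a complex scalar serve as the real-linear operator
  \<open>C\<close> in the intertwining lemmas.\<close>

lemma bounded_linear_scaleC: "bounded_linear (\<lambda>x::'a::chilbert_space. c *\<^sub>C x)"
proof (rule bounded_linear_intro)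
  show "norm (c *\<^sub>C x) \<le> norm x * cmod c" for x :: 'a
  proof -
    have "complex_of_real ((norm (c *\<^sub>C x))\<^sup>2) = complex_of_real ((norm x * cmod c)\<^sup>2)"
      unfolding cinner_self[symmetric] power_mult_distrib of_real_mult complex_norm_square
      by (simp only: cinner_simps mult_ac)
    then have "(norm (c *\<^sub>C x))\<^sup>2 = (norm x * cmod c)\<^sup>2" by (simp only: of_real_eq_iff)
    then show ?thesis by simp
  qed
qed (simp_all add: scaleC_add_right scaleR_scaleC scaleC_scaleC mult.commute)

text \<open>In operator order this is \<open>T^2 <= c T\<close>: Cauchy-Schwarz for the form against
  \<open>T x\<close>, divided by the square of \<open>norm (T x)\<close>.\<close>

lemma positive_op_norm_square_le:
  assumes T: "positive_op T" and le: "\<And>x. norm (T x) \<le> c * norm x"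
  shows "(norm (T x))\<^sup>2 \<le> c * Re (cinner (T x) x)"
proof (cases "T x = 0")
  case False
  have "((norm (T x))\<^sup>2)\<^sup>2 \<le> Re (cinner (T x) x) * Re (cinner (T (T x)) (T x))"
    using positive_op_Cauchy_Schwarz[OF T, of x "T x"] by (simp add: cinner_self norm_power)
  also have "\<dots> \<le> Re (cinner (T x) x) * (c * (norm (T x))\<^sup>2)"
  proof (rule mult_left_mono)
    have "Re (cinner (T (T x)) (T x)) \<le> norm (T (T x)) * norm (T x)"
      by (meson Cauchy_Schwarz_cinner complex_Re_le_cmod order_trans)
    also have "\<dots> \<le> c * norm (T x) * norm (T x)" by (intro mult_right_mono le) simp
    finally show "Re (cinner (T (T x)) (T x)) \<le> c * (norm (T x))\<^sup>2"
      by (simp add: power2_eq_square mult.assoc)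
  qed (rule positive_op_cinner_self[OF T])
  finally have "(norm (T x))\<^sup>2 * (norm (T x))\<^sup>2 \<le> (c * Re (cinner (T x) x)) * (norm (T x))\<^sup>2"
    by (simp add: power2_eq_square mult_ac)
  then show ?thesis by (rule mult_right_le_imp_le) (use False in simp)
qed (simp add: power2_eq_square)

text \<open>The square root of \<open>T\<close> for any \<open>c > 0\<close> with \<open>\<parallel>T\<parallel> \<le> c\<close>, obtained by rescaling to \<open>T / c\<close>.\<close>

definition sqrt_scaled :: "real \<Rightarrow> ('a::chilbert_space \<Rightarrow> 'a) \<Rightarrow> 'a \<Rightarrow> 'a" where
  "sqrt_scaled c T x = sqrt c *\<^sub>R (x - sqrt_lim (id_blinfun - (1 / c) *\<^sub>R Blinfun T) x)"

context
  fixes c :: real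
  assumes c: "0 < c"
begin

lemma norm_id_minus_scaled:
  assumes T: "positive_op T" and le: "\<And>x. norm (T x) \<le> c * norm x"
  shows "norm (id_blinfun - (1 / c) *\<^sub>R Blinfun T) \<le> 1"
proof (rule norm_blinfun_bound)
  fix x
  have "(norm (x - (1 / c) *\<^sub>R T x))\<^sup>2 =
      (norm x)\<^sup>2 - 2 / c * Re (cinner (T x) x) + (norm (T x))\<^sup>2 / c\<^sup>2"
    unfolding Re_cinner_self[symmetric]
    using Re_cinner_commute[of x "T x"] by (simp add: cinner_simps power2_eq_square algebra_simps)
  \<comment> \<open>The quadratic term is absorbed by half of the negative linear term.\<close>
  also have "\<dots> \<le> (norm x)\<^sup>2 - 2 / c * Re (cinner (T x) x) + c * Re (cinner (T x) x) / c\<^sup>2"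
    using positive_op_norm_square_le[OF T le] by (intro add_left_mono divide_right_mono) auto
  also have "\<dots> = (norm x)\<^sup>2 - Re (cinner (T x) x) / c"
    using c by (simp add: power2_eq_square)
  also have "\<dots> \<le> (norm x)\<^sup>2"
    using positive_op_cinner_self(2)[OF T] c by simp
  finally have "norm (x - (1 / c) *\<^sub>R T x) \<le> norm x" by (rule power2_le_imp_le) simp
  then show "norm ((id_blinfun - (1 / c) *\<^sub>R Blinfun T) x) \<le> 1 * norm x"
    using positive_op_imp_bounded_linear[OF T]
    by (simp add: blinfun.bilinear_simps bounded_linear_Blinfun_apply)
qed simp

lemma sqrt_scaled_intertwines:
  assumes T: "positive_op T" "\<And>x. norm (T x) \<le> c * norm x"
    and T': "positive_op T'" "\<And>x. norm (T' x) \<le> c * norm x"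
    and C: "bounded_linear C" and CT: "\<And>x. C (T x) = T' (C x)"
  shows "C (sqrt_scaled c T x) = sqrt_scaled c T' (C x)"
proof -
  interpret C: bounded_linear C by fact
  note bl = positive_op_imp_bounded_linear[OF T(1)] positive_op_imp_bounded_linear[OF T'(1)]
  show ?thesis
    unfolding sqrt_scaled_def C.scaleR C.diff
    by (subst sqrt_lim_intertwines[OF norm_id_minus_scaled[OF T] norm_id_minus_scaled[OF T'] _ C])
      (simp_all add: blinfun.bilinear_simps bounded_linear_Blinfun_apply bl C.diff C.scaleR CT)
qed

lemma sqrt_scaled_square:
  assumes T: "positive_op T" "\<And>x. norm (T x) \<le> c * norm x"
  shows "sqrt_scaled c T (sqrt_scaled c T x) = T x"
proof -
  define B where "B = id_blinfun - (1 / c) *\<^sub>R Blinfun T"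
  define Y where "Y = sqrt_lim B"
  have "Y = (1/2) *\<^sub>R (B + (Y o\<^sub>L Y))"
    unfolding Y_def using norm_id_minus_scaled[OF T] by (intro sqrt_lim_fixpoint) (simp add: B_def)
  then have "2 *\<^sub>R Y x = B x + Y (Y x)"
    by (metis (no_types, lifting) blinfun.add_left blinfun.scaleR_left blinfun_apply_blinfun_compose
        divide_self_if nonzero_eq_divide_eq scaleR_one scaleR_scaleR times_divide_eq_right
        zero_neq_numeral)
  then have "x - Y x - Y (x - Y x) = x - B x"
    by (simp add: blinfun.bilinear_simps scaleR_2 algebra_simps)
  also have "\<dots> = (1 / c) *\<^sub>R T x"
    using positive_op_imp_bounded_linear[OF T(1)]
    by (simp add: B_def blinfun.bilinear_simps bounded_linear_Blinfun_apply)
  finally have *: "x - Y x - Y (x - Y x) = (1 / c) *\<^sub>R T x" .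
  have "sqrt_scaled c T (sqrt_scaled c T x) = (sqrt c * sqrt c) *\<^sub>R (x - Y x - Y (x - Y x))"
    by (simp add: sqrt_scaled_def Y_def B_def blinfun.bilinear_simps algebra_simps)
  then show ?thesis using c by (simp add: *)
qed

text \<open>\<open>Y\<close> is symmetric of norm at most 1, so its form is real and at most the
  square of \<open>norm x\<close>; hence \<open>1 - Y\<close> is positive.\<close>

lemma positive_op_sqrt_scaled:
  assumes T: "positive_op T" "\<And>x. norm (T x) \<le> c * norm x"
  shows "positive_op (sqrt_scaled c T)"
proof -
  define B where "B = id_blinfun - (1 / c) *\<^sub>R Blinfun T"
  define Y where "Y = sqrt_lim B"
  have B: "B x = x - (1 / c) *\<^sub>R T x" for x
    using positive_op_imp_bounded_linear[OF T(1)]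
    by (simp add: B_def blinfun.bilinear_simps bounded_linear_Blinfun_apply)
  have nB: "norm B \<le> 1" unfolding B_def by (rule norm_id_minus_scaled[OF T])
  have S: "sqrt_scaled c T = (\<lambda>x. sqrt c *\<^sub>R (x - Y x))"
    by (simp add: fun_eq_iff sqrt_scaled_def Y_def B_def)
  have sym: "cinner (Y x) y = cinner x (Y y)" for x y
    unfolding Y_def
    by (rule sqrt_lim_symmetric[OF nB]) (simp add: B cinner_simps positive_op_symmetric[OF T(1)])
  have "bounded_linear (sqrt_scaled c T)"
    unfolding S by (intro bounded_linear_intros)
  \<comment> \<open>The limit is formed among real-linear operators; complex homogeneity holds
    because \<open>T\<close> commutes with complex scalars.\<close>
  moreover have "sqrt_scaled c T (d *\<^sub>C x) = d *\<^sub>C sqrt_scaled c T x" for d x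
    using sqrt_scaled_intertwines[OF T T bounded_linear_scaleC] T(1)
    by (simp add: positive_op_def bounded_clinear_def)
  moreover have "cinner (sqrt_scaled c T x) x \<in> \<real>\<^sub>\<ge>\<^sub>0" for x
  proof -
    have "Im (cinner (Y x) x) = 0"
      using cinner_commute[of "Y x" x] sym[of x x] by (simp add: complex_eq_iff)
    moreover have "Re (cinner (Y x) x) \<le> (norm x)\<^sup>2"
    proof -
      have "Re (cinner (Y x) x) \<le> norm (Y x) * norm x"
        by (meson Cauchy_Schwarz_cinner complex_Re_le_cmod order_trans)
      also have "\<dots> \<le> norm x * norm x"
      proof (rule mult_right_mono)
        have "norm (Y x) \<le> norm Y * norm x" by (rule norm_blinfun)
        also have "\<dots> \<le> 1 * norm x"
          using norm_sqrt_lim[OF nB] by (intro mult_right_mono) (simp_all add: Y_def)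
        finally show "norm (Y x) \<le> norm x" by simp
      qed simp
      finally show ?thesis by (simp add: power2_eq_square)
    qed
    ultimately show ?thesis
      using c by (simp add: S cinner_simps complex_nonneg_Reals_iff cinner_self Re_power2)
  qed
  ultimately show ?thesis by (simp add: positive_op_def bounded_clinear_def)
qed

text \<open>\<open>R\<close> commutes with \<open>T = R o R\<close>, hence with the limit
  \<open>S\<close>. So \<open>S + R\<close> kills \<open>y = S x - R x\<close>; both nonnegative
  forms vanish at \<open>y\<close>, whence \<open>S y = R y = 0\<close>.\<close>

lemma sqrt_scaled_unique:
  assumes T: "positive_op T" "\<And>x. norm (T x) \<le> c * norm x"
    and R: "positive_op R" "R \<circ> R = T"
  shows "R = sqrt_scaled c T"
proof
  fix x
  define S where "S = sqrt_scaled c T"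
  have S: "positive_op S" unfolding S_def by (rule positive_op_sqrt_scaled[OF T])
  interpret R: bounded_linear R using R(1) by (rule positive_op_imp_bounded_linear)
  interpret S: bounded_linear S using S by (rule positive_op_imp_bounded_linear)
  have RR: "R (R z) = T z" for z using R(2) by (auto simp: fun_eq_iff)
  have SS: "S (S z) = T z" for z unfolding S_def by (rule sqrt_scaled_square[OF T])
  have comm: "R (S z) = S (R z)" for z
    unfolding S_def
    by (rule sqrt_scaled_intertwines[OF T T R.bounded_linear_axioms]) (simp add: RR[symmetric])
  define y where "y = S x - R x"
  have "S y + R y = 0" by (simp add: y_def S.diff R.diff comm SS RR)
  then have "Re (cinner (S y) y) + Re (cinner (R y) y) = 0"
    by (simp flip: cinner_add_left plus_complex.sel)
  then have "Re (cinner (S y) y) = 0" "Re (cinner (R y) y) = 0"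
    using positive_op_cinner_self(2)[OF S, of y] positive_op_cinner_self(2)[OF R(1), of y] by auto
  then have "S y = 0" "R y = 0" using positive_op_eq_0 S R(1) by blast+
  \<comment> \<open>By symmetry \<open>cinner y y\<close> equals
    \<open>cinner x (S y - R y)\<close>.\<close>
  then have "cinner y y = 0"
    by (subst (1) y_def) (simp add: cinner_simps positive_op_symmetric[OF S]
        positive_op_symmetric[OF R(1)])
  then show "R x = sqrt_scaled c T x" by (simp add: cinner_self y_def S_def)
qed

lemma sqrt_op_eq_sqrt_scaled:
  assumes T: "positive_op T" "\<And>x. norm (T x) \<le> c * norm x"
  shows "sqrt_op T = sqrt_scaled c T"
  unfolding sqrt_op_def
proof (rule the_equality)
  show "positive_op (sqrt_scaled c T) \<and> sqrt_scaled c T \<circ> sqrt_scaled c T = T"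
    by (simp add: fun_eq_iff positive_op_sqrt_scaled[OF T] sqrt_scaled_square[OF T])
  show "S = sqrt_scaled c T" if "positive_op S \<and> S \<circ> S = T" for S
    using that by (intro sqrt_scaled_unique T) auto
qed

end

text \<open>Intertwining two scaled roots requires the same \<open>c\<close> for both
  operators.\<close>

lemma positive_op_bounds:
  assumes "positive_op T" "positive_op T'"
  shows "\<exists>c>0. (\<forall>x. norm (T x) \<le> c * norm x) \<and> (\<forall>x. norm (T' x) \<le> c * norm x)"
proof -
  obtain K K' where K: "0 < K" "\<And>x. norm (T x) \<le> norm x * K"
    and K': "0 < K'" "\<And>x. norm (T' x) \<le> norm x * K'"
    using bounded_linear.pos_bounded[OF positive_op_imp_bounded_linear[OF assms(1)]]
      bounded_linear.pos_bounded[OF positive_op_imp_bounded_linear[OF assms(2)]] by blast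
  show ?thesis
  proof (intro exI[of _ "max K K'"] conjI allI)
    show "norm (T x) \<le> max K K' * norm x" for x
      using K(2)[of x] mult_left_mono[OF max.cobounded1[of K K'] norm_ge_zero[of x]]
      by (simp add: mult.commute)
    show "norm (T' x) \<le> max K K' * norm x" for x
      using K'(2)[of x] mult_left_mono[OF max.cobounded2[of K' K] norm_ge_zero[of x]]
      by (simp add: mult.commute)
  qed (use K in simp)
qed

lemma
  assumes T: "positive_op T"
  shows positive_op_sqrt_op: "positive_op (sqrt_op T)"
    and sqrt_op_square: "sqrt_op T (sqrt_op T x) = T x"
proof -
  obtain c where c: "0 < c" "\<And>x. norm (T x) \<le> c * norm x"
    using positive_op_bounds[OF T T] by auto
  show "positive_op (sqrt_op T)" "sqrt_op T (sqrt_op T x) = T x"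
    using positive_op_sqrt_scaled[OF c(1) T c(2)] sqrt_scaled_square[OF c(1) T c(2)]
    by (simp_all only: sqrt_op_eq_sqrt_scaled[OF c(1) T c(2)])
qed

lemma sqrt_op_intertwines:
  assumes T: "positive_op T" and T': "positive_op T'"
    and "bounded_linear C" "\<And>x. C (T x) = T' (C x)"
  shows "C (sqrt_op T x) = sqrt_op T' (C x)"
proof -
  obtain c where c: "0 < c" "\<And>x. norm (T x) \<le> c * norm x" "\<And>x. norm (T' x) \<le> c * norm x"
    using positive_op_bounds[OF T T'] by auto
  show ?thesis
    unfolding sqrt_op_eq_sqrt_scaled[OF c(1) T c(2)] sqrt_op_eq_sqrt_scaled[OF c(1) T' c(3)]
    by (intro sqrt_scaled_intertwines c T T' assms(3,4))
qed

section \<open>The mixed Schwarz inequality\<close>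

text \<open>\<open>Riesz_subspace\<close> asks for a closed subspace, and the range of
  \<open>|A|\<close> need not be closed.\<close>

lemma subspace_closure:
  fixes V :: "'a::real_normed_vector set"
  assumes "subspace V"
  shows "subspace (closure V)"
proof (rule subspaceI)
  show "0 \<in> closure V" using subspace_0[OF assms] closure_subset by blast
next
  fix x y assume "x \<in> closure V" "y \<in> closure V"
  then obtain X Y where "\<forall>n. X n \<in> V" "X \<longlonglongrightarrow> x" "\<forall>n. Y n \<in> V" "Y \<longlonglongrightarrow> y"
    unfolding closure_sequential by blast
  then show "x + y \<in> closure V"
    unfolding closure_sequential
    by (intro exI[of _ "\<lambda>n. X n + Y n"]) (auto intro: tendsto_add subspace_add[OF assms])
next
  fix c x assume "x \<in> closure V"
  then obtain X where "\<forall>n. X n \<in> V" "X \<longlonglongrightarrow> x"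
    unfolding closure_sequential by blast
  then show "c *\<^sub>R x \<in> closure V"
    unfolding closure_sequential
    by (intro exI[of _ "\<lambda>n. c *\<^sub>R X n"])
      (auto intro: tendsto_scaleR subspace_scale[OF assms])
qed

lemma positive_op_abs_op: "bounded_clinear A \<Longrightarrow> positive_op (abs_op A)"
  unfolding abs_op_def by (intro positive_op_sqrt_op positive_op_adjoint_compose)

lemma abs_op_square: "bounded_clinear A \<Longrightarrow> abs_op A (abs_op A x) = adjoint_op A (A x)"
  unfolding abs_op_def by (simp add: sqrt_op_square positive_op_adjoint_compose)

text \<open>\<open>A\<close> intertwines \<open>adjoint_op A o A\<close> with
  \<open>A o adjoint_op A\<close>, and the relation passes to the square roots.\<close>

lemma abs_op_intertwines:
  assumes A: "bounded_clinear A"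
  shows "A (abs_op A x) = abs_op (adjoint_op A) (A x)"
  unfolding abs_op_def
  using A by (intro sqrt_op_intertwines positive_op_adjoint_compose bounded_clinear_adjoint_op
      bounded_clinear_imp_bounded_linear) (simp_all add: adjoint_op_adjoint_op)

text \<open>For \<open>x = |A| u\<close> we have \<open>A x = |A\<^sup>*| A u\<close>, and the inequality is the Cauchy--Schwarz
  inequality for the form of \<open>|A\<^sup>*|\<close>. It extends to the closure of the range of \<open>|A|\<close>, while
  both sides vanish on the orthogonal complement, which is the common kernel of \<open>|A|\<close> and \<open>A\<close>.\<close>

lemma mixed_Schwarz:
  assumes A: "bounded_clinear A"
  shows "(cmod (cinner (A x) y))\<^sup>2 \<le>
    Re (cinner (abs_op A x) x) * Re (cinner (abs_op (adjoint_op A) y) y)"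
proof -
  define P where "P = abs_op A"
  define Q where "Q = abs_op (adjoint_op A)"
  have P: "positive_op P" and Q: "positive_op Q"
    by (simp_all add: P_def Q_def positive_op_abs_op bounded_clinear_adjoint_op A)
  interpret A: bounded_linear A using A by (rule bounded_clinear_imp_bounded_linear)
  interpret P: bounded_linear P using P by (rule positive_op_imp_bounded_linear)
  have PP: "P (P u) = adjoint_op A (A u)" for u
    unfolding P_def by (rule abs_op_square[OF A])
  have AP: "A (P u) = Q (A u)" for u
    unfolding P_def Q_def by (rule abs_op_intertwines[OF A])
  define V where "V = closure (range P)"
  have V: "subspace V" "closed V"
    unfolding V_def
    by (auto intro!: subspace_closure linear_subspace_image P.linear_axioms)
  have on_V: "(cmod (cinner (A v) y))\<^sup>2 \<le> Re (cinner (P v) v) * Re (cinner (Q y) y)"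
    if "v \<in> V" for v
  proof -
    let ?G = "{v. (cmod (cinner (A v) y))\<^sup>2 \<le> Re (cinner (P v) v) * Re (cinner (Q y) y)}"
    have "closed ?G"
      by (intro closed_Collect_le continuous_intros A.continuous_on P.continuous_on)
    moreover have "range P \<subseteq> ?G"
    proof clarify
      fix u
      \<comment> \<open>Moving \<open>A\<close> across turns \<open>cinner (A (P u)) (A u)\<close>
        into \<open>cinner (P u) (P (P u))\<close>.\<close>
      have "cinner (Q (A u)) (A u) = cinner (P (P u)) (P u)"
        by (simp add: AP[symmetric] cinner_adjoint_op[OF A] PP[symmetric] positive_op_symmetric[OF P])
      then show "(cmod (cinner (A (P u)) y))\<^sup>2 \<le> Re (cinner (P (P u)) (P u)) * Re (cinner (Q y) y)"
        using positive_op_Cauchy_Schwarz[OF Q, of "A u" y] by (simp add: AP)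
    qed
    ultimately have "V \<subseteq> ?G" unfolding V_def by (rule closure_minimal[rotated])
    with that show ?thesis by blast
  qed
  have "bounded_linear (\<lambda>v. Re (cinner v x))"
    by (intro bounded_linear_compose[OF bounded_linear_Re]
        bounded_bilinear.bounded_linear_left[OF bounded_bilinear_cinner])
  from Riesz_subspace[OF this V]
  obtain v where v: "v \<in> V" "\<And>h. h \<in> V \<Longrightarrow> Re (cinner h v) = Re (cinner h x)" by blast
  define w where "w = x - v"
  \<comment> \<open>As \<open>w\<close> is orthogonal to \<open>V\<close>, testing against
    \<open>P (P w)\<close> yields the squared norm of \<open>P w\<close>.\<close>
  have "P (P w) \<in> V" unfolding V_def by (rule subsetD[OF closure_subset]) blast
  then have "Re (cinner (P (P w)) w) = 0" using v(2) by (simp add: w_def cinner_diff_right)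
  then have Pw: "P w = 0" by (simp add: positive_op_symmetric[OF P] cinner_self)
  have "cinner (A w) (A w) = cinner w (P (P w))" by (simp add: cinner_adjoint_op[OF A] PP)
  then have Aw: "A w = 0" by (simp add: Pw P.zero cinner_self)
  have "x = v + w" by (simp add: w_def)
  then have "A x = A v" "P x = P v" by (simp_all add: A.add P.add Aw Pw)
  \<comment> \<open>The cross term \<open>cinner (P v) w\<close> equals
    \<open>cinner v (P w)\<close>, which is 0.\<close>
  moreover have "cinner (P v) x = cinner (P v) v"
    using \<open>x = v + w\<close> by (simp add: cinner_add_right positive_op_symmetric[OF P, of v w] Pw)
  ultimately show ?thesis using on_V[OF v(1)] by (simp add: P_def Q_def)
qed

section \<open>The numerical radius\<close>

lemma bdd_above_numerical_range:
  assumes "bounded_linear T"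
  shows "bdd_above (insert 0 {cmod (cinner (T x) x) | x. norm x = 1})"
proof (rule bdd_aboveI)
  fix r assume r: "r \<in> insert 0 {cmod (cinner (T x) x) | x. norm x = 1}"
  have "cmod (cinner (T x) x) \<le> onorm T" if "norm x = 1" for x
    using Cauchy_Schwarz_cinner[of "T x" x] onorm[OF assms, of x] that by simp
  with r show "r \<le> onorm T" using onorm_pos_le[OF assms] by auto
qed

lemma cinner_le_numerical_radius:
  "bounded_linear T \<Longrightarrow> norm x = 1 \<Longrightarrow> cmod (cinner (T x) x) \<le> numerical_radius T"
  unfolding numerical_radius_def by (intro cSup_upper bdd_above_numerical_range) auto

lemma numerical_radius_nonneg: "bounded_linear T \<Longrightarrow> 0 \<le> numerical_radius T"
  unfolding numerical_radius_def by (intro cSup_upper bdd_above_numerical_range) auto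

text \<open>Bounding the supremum by \<open>sqrt r\<close> avoids squaring under it;
  \<open>0 <= r\<close> accounts for the inserted 0.\<close>

lemma numerical_radius_square_le:
  assumes T: "bounded_linear T" and "0 \<le> r"
    and le: "\<And>x. norm x = 1 \<Longrightarrow> (cmod (cinner (T x) x))\<^sup>2 \<le> r"
  shows "(numerical_radius T)\<^sup>2 \<le> r"
proof -
  have "numerical_radius T \<le> sqrt r"
    unfolding numerical_radius_def
    by (rule cSup_least) (use assms in \<open>auto simp: real_le_rsqrt\<close>)
  then show ?thesis
    using power_mono[OF _ numerical_radius_nonneg[OF T], of "sqrt r" 2] \<open>0 \<le> r\<close> by simp
qed

theorem corollary2p1:
  fixes A :: "'a::chilbert_space \<Rightarrow> 'a"
  assumes "bounded_clinear A"
  shows "(numerical_radius A)\<^sup>2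
           \<le> 1 / 2 * (numerical_radius (\<lambda>x. abs_op A x + \<i> *\<^sub>C abs_op (adjoint_op A) x))\<^sup>2
       \<and> 1 / 2 * (numerical_radius (\<lambda>x. abs_op A x + \<i> *\<^sub>C abs_op (adjoint_op A) x))\<^sup>2
           \<le> 1 / 2 * onorm (\<lambda>x. (abs_op A ^^ 2) x + (abs_op (adjoint_op A) ^^ 2) x)"
proof -
  define P where "P = abs_op A"
  define Q where "Q = abs_op (adjoint_op A)"
  define M where "M = (\<lambda>x. P x + \<i> *\<^sub>C Q x)"
  define N where "N = (\<lambda>x. (P ^^ 2) x + (Q ^^ 2) x)"
  have P: "positive_op P" and Q: "positive_op Q"
    by (simp_all add: P_def Q_def positive_op_abs_op bounded_clinear_adjoint_op assms)
  note bl = positive_op_imp_bounded_linear[OF P] positive_op_imp_bounded_linear[OF Q]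
  have M: "bounded_linear M"
    unfolding M_def by (intro bounded_linear_add bl bounded_linear_compose[OF bounded_linear_scaleC])
  have N: "bounded_linear N"
    unfolding N_def
    by (simp add: numeral_2_eq_2) (intro bounded_linear_add bl bounded_linear_compose[of P]
        bounded_linear_compose[of Q])
  have A: "bounded_linear A" using assms by (rule bounded_clinear_imp_bounded_linear)
  \<comment> \<open>Both forms are real, so they are the real and imaginary parts of the form of
    \<open>M\<close>.\<close>
  have M_sq: "(cmod (cinner (M x) x))\<^sup>2 = (Re (cinner (P x) x))\<^sup>2 + (Re (cinner (Q x) x))\<^sup>2" for x
  proof -
    have "cinner (M x) x = Complex (Re (cinner (P x) x)) (Re (cinner (Q x) x))"
      using positive_op_cinner_self(1)[OF P, of x] positive_op_cinner_self(1)[OF Q, of x]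
      by (simp add: M_def cinner_simps complex_eq_iff)
    then show ?thesis by (simp add: cmod_power2)
  qed
  have "(numerical_radius A)\<^sup>2 \<le> 1 / 2 * (numerical_radius M)\<^sup>2"
  proof (rule numerical_radius_square_le[OF A])
    fix x :: 'a assume x: "norm x = 1"
    have "(cmod (cinner (A x) x))\<^sup>2 \<le> Re (cinner (P x) x) * Re (cinner (Q x) x)"
      unfolding P_def Q_def by (rule mixed_Schwarz[OF assms])
    also have "\<dots> \<le> 1 / 2 * (cmod (cinner (M x) x))\<^sup>2"
      using sum_squares_bound[of "Re (cinner (P x) x)" "Re (cinner (Q x) x)"] by (simp add: M_sq)
    also have "\<dots> \<le> 1 / 2 * (numerical_radius M)\<^sup>2"
      using cinner_le_numerical_radius[OF M x] by (simp add: power_mono)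
    finally show "(cmod (cinner (A x) x))\<^sup>2 \<le> 1 / 2 * (numerical_radius M)\<^sup>2" .
  qed simp
  moreover have "(numerical_radius M)\<^sup>2 \<le> onorm N"
  proof (rule numerical_radius_square_le[OF M onorm_pos_le[OF N]])
    fix x :: 'a assume x: "norm x = 1"
    \<comment> \<open>For a unit vector Cauchy-Schwarz bounds the form by \<open>norm (R x)\<close>,
      whose square is the form of \<open>R o R\<close> by symmetry.\<close>
    have sq: "(Re (cinner (R x) x))\<^sup>2 \<le> Re (cinner (R (R x)) x)" if R: "positive_op R" for R
    proof -
      have "\<bar>Re (cinner (R x) x)\<bar> \<le> norm (R x)"
        using abs_Re_le_cmod[of "cinner (R x) x"] Cauchy_Schwarz_cinner[of "R x" x] x by simp
      then have "(Re (cinner (R x) x))\<^sup>2 \<le> (norm (R x))\<^sup>2" by (metis abs_le_square_iff abs_norm_cancel)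
      then show ?thesis by (simp add: positive_op_symmetric[OF R, of "R x"] Re_cinner_self)
    qed
    have "N x = P (P x) + Q (Q x)" by (simp add: N_def numeral_2_eq_2)
    then have "(cmod (cinner (M x) x))\<^sup>2 \<le> Re (cinner (N x) x)"
      using sq[OF P] sq[OF Q] by (simp add: M_sq cinner_add_left)
    also have "\<dots> \<le> norm (N x) * norm x"
      by (meson Cauchy_Schwarz_cinner complex_Re_le_cmod order_trans)
    also have "\<dots> \<le> onorm N" using onorm[OF N, of x] x by simp
    finally show "(cmod (cinner (M x) x))\<^sup>2 \<le> onorm N" .
  qed
  ultimately show ?thesis by (simp add: M_def N_def P_def Q_def)
qed

end
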